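(* Let $(\mathcal V,\otimes,I,\lambda,\rho,\alpha)$ be a monoidal category, let $H:\mathcal V\to\mathcal V$ be an endofunctor, and let $\theta$ be a pointed tensorial strength for $H$. Let $(t,\eta,\tau)$ be a monoidal heterogeneous substitution system (MHSS) for $(\mathcal V,H,\theta)$, and let $\mu: t\otimes t\to t$ be the unique morphism that the MHSS property associates with the triple $(z,e,f)=(t,\eta,1_t)$. Then $(t,\eta,\mu,\tau)$ is an $(H,\theta)$-monoid.
   Context: Composition of morphisms is written in diagrammatic order: for $f:a\to b$ and $g:b\to c$, $f\cdot g:a\to c$. In a monoidal category the unitors and associator have components $\lambda_x:I\otimes x\to x$, $\rho_x:x\otimes I\to x$, $\alpha_{x,y,z}:(x\otimes y)\otimes z\to x\otimes(y\otimes z)$. Monoidal-pointed objects: the coslice category $I/\mathcal V$ has as objects pairs $(v,p)$ with $v$ an object of $\mathcal V$ and $p:I\to v$; its morphisms are the $\mathcal V$-morphisms commuting with the points. It is monoidal with unit $I^{ptd}:=(I,1_I)$ and tensor $(v,p)\otimes^{ptd}(w,q):=(v\otimes w,\ \lambda_I^{-1}\cdot(p\otimes q))$. Pointed tensorial strength for an endofunctor $H$ on $\mathcal V$: a family $\theta_{(v,p),x}:v\otimes Hx\to H(v\otimes x)$, natural in $(v,p)\in I/\mathcal V$ and in $x\in\mathcal V$, such that for all arguments (i) $\theta_{I^{ptd},x}\cdot H\lambda_x=\lambda_{Hx}$, and (ii) $\theta_{(v,p)\otimes^{ptd}(w,q),x}\cdot H\alpha_{v,w,x}=\alpha_{v,w,Hx}\cdot(1_v\otimes\theta_{(w,q),x})\cdot\theta_{(v,p),w\otimes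 x}$. MHSS for $(\mathcal V,H,\theta)$: a triple $(t,\eta,\tau)$ with $t$ an object of $\mathcal V$, $\eta:I\to t$ and $\tau:Ht\to t$, such that for every triple $(z,e,f)$ with $z$ an object of $\mathcal V$, $e:I\to z$ and $f:z\to t$ (arbitrary $\mathcal V$-morphisms), there is a unique morphism $h:z\otimes t\to t$ with $(1_z\otimes\eta)\cdot h=\rho_z\cdot f$ and $(1_z\otimes\tau)\cdot h=\theta_{(z,e),t}\cdot Hh\cdot\tau$. $\mathcal V$-monoid: a triple $(v,\eta,\mu)$ with $\eta:I\to v$, $\mu:v\otimes v\to v$ such that $(\eta\otimes 1_v)\cdot\mu=\lambda_v$, $(1_v\otimes\eta)\cdot\mu=\rho_v$ and $(\mu\otimes 1_v)\cdot\mu=\alpha_{v,v,v}\cdot(1_v\otimes\mu)\cdot\mu$. $(H,\theta)$-monoid: a quadruple $(v,\eta,\mu,\tau)$ with $(v,\eta,\mu)$ a $\mathcal V$-monoid and $\tau:Hv\to v$ such that $(1_v\otimes\tau)\cdot\mu=\theta_{(v,\eta),v}\cdot H\mu\cdot\tau$. *)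

theory Defs
  imports Main
begin

section \<open>Categories, functors and natural transformations\<close>

text \<open>
  Objects and arrows are carrier sets in two arbitrary types, and each arrow determines its source
  and target. Composition is written in diagrammatic order. All operations are total functions in
  the logic; their values outside the carriers are never constrained.
\<close>

record ('o, 'm) cat =
  obj :: "'o set"
  arr :: "'m set"
  src :: "'m \<Rightarrow> 'o"
  trg :: "'m \<Rightarrow> 'o"
  ident :: "'o \<Rightarrow> 'm" ("\<one>\<index>")
  cmp :: "'m \<Rightarrow> 'm \<Rightarrow> 'm" (infixl "\<cdot>\<index>" 60)

definition hom :: "('o, 'm, 'x) cat_scheme \<Rightarrow> 'o \<Rightarrow> 'o \<Rightarrow> 'm set" where
  "hom C a b = {f \<in> arr C. src C f = a \<and> trg C f = b}"

locale category =
  fixes C :: "('o, 'm, 'x) cat_scheme" (structure)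
  assumes src_obj: "f \<in> arr C \<Longrightarrow> src C f \<in> obj C"
    and trg_obj: "f \<in> arr C \<Longrightarrow> trg C f \<in> obj C"
    and ident_hom: "a \<in> obj C \<Longrightarrow> \<one> a \<in> hom C a a"
    and cmp_hom: "\<lbrakk>f \<in> hom C a b; g \<in> hom C b c\<rbrakk> \<Longrightarrow> f \<cdot> g \<in> hom C a c"
    and ident_cmp: "f \<in> hom C a b \<Longrightarrow> \<one> a \<cdot> f = f"
    and cmp_ident: "f \<in> hom C a b \<Longrightarrow> f \<cdot> \<one> b = f"
    and cmp_assoc: "\<lbrakk>f \<in> hom C a b; g \<in> hom C b c; h \<in> hom C c d\<rbrakk>
      \<Longrightarrow> (f \<cdot> g) \<cdot> h = f \<cdot> (g \<cdot> h)"

definition inverse_arrows :: "('o, 'm, 'x) cat_scheme \<Rightarrow> 'm \<Rightarrow> 'm \<Rightarrow> bool" where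
  "inverse_arrows C f g \<longleftrightarrow>
     f \<in> arr C \<and> g \<in> hom C (trg C f) (src C f) \<and>
     f \<cdot>\<^bsub>C\<^esub> g = \<one>\<^bsub>C\<^esub> (src C f) \<and> g \<cdot>\<^bsub>C\<^esub> f = \<one>\<^bsub>C\<^esub> (trg C f)"

definition iso_arrow :: "('o, 'm, 'x) cat_scheme \<Rightarrow> 'm \<Rightarrow> bool" where
  "iso_arrow C f \<longleftrightarrow> (\<exists>g. inverse_arrows C f g)"

definition inv_arrow :: "('o, 'm, 'x) cat_scheme \<Rightarrow> 'm \<Rightarrow> 'm" where
  "inv_arrow C f = (THE g. inverse_arrows C f g)"

record ('o, 'm, 'p, 'n) functor_maps =
  fobj :: "'o \<Rightarrow> 'p"
  farr :: "'m \<Rightarrow> 'n"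

locale cat_functor = C: category C + D: category D
  for C :: "('o, 'm, 'x) cat_scheme" and D :: "('p, 'n, 'y) cat_scheme" +
  fixes F :: "('o, 'm, 'p, 'n) functor_maps"
  assumes fobj_obj: "a \<in> obj C \<Longrightarrow> fobj F a \<in> obj D"
    and farr_hom: "f \<in> hom C a b \<Longrightarrow> farr F f \<in> hom D (fobj F a) (fobj F b)"
    and farr_ident: "a \<in> obj C \<Longrightarrow> farr F (\<one>\<^bsub>C\<^esub> a) = \<one>\<^bsub>D\<^esub> (fobj F a)"
    and farr_cmp: "\<lbrakk>f \<in> hom C a b; g \<in> hom C b c\<rbrakk>
      \<Longrightarrow> farr F (f \<cdot>\<^bsub>C\<^esub> g) = farr F f \<cdot>\<^bsub>D\<^esub> farr F g"

locale natural_transformation = F: cat_functor C D F + G: cat_functor C D G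
  for C :: "('o, 'm, 'x) cat_scheme" and D :: "('p, 'n, 'y) cat_scheme"
    and F G :: "('o, 'm, 'p, 'n) functor_maps" +
  fixes T :: "'o \<Rightarrow> 'n"
  assumes component_hom: "a \<in> obj C \<Longrightarrow> T a \<in> hom D (fobj F a) (fobj G a)"
    and naturality: "f \<in> hom C a b
      \<Longrightarrow> farr F f \<cdot>\<^bsub>D\<^esub> T b = T a \<cdot>\<^bsub>D\<^esub> farr G f"

locale natural_isomorphism = natural_transformation +
  assumes component_iso: "a \<in> obj C \<Longrightarrow> iso_arrow D (T a)"

definition prod_cat ::
  "('o, 'm, 'x) cat_scheme \<Rightarrow> ('p, 'n, 'y) cat_scheme \<Rightarrow> ('o \<times> 'p, 'm \<times> 'n) cat" where
  "prod_cat C D =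
    \<lparr> obj = obj C \<times> obj D,
      arr = arr C \<times> arr D,
      src = (\<lambda>(f, g). (src C f, src D g)),
      trg = (\<lambda>(f, g). (trg C f, trg D g)),
      ident = (\<lambda>(a, b). (\<one>\<^bsub>C\<^esub> a, \<one>\<^bsub>D\<^esub> b)),
      cmp = (\<lambda>(f, g) (f', g'). (f \<cdot>\<^bsub>C\<^esub> f', g \<cdot>\<^bsub>D\<^esub> g')) \<rparr>"

text \<open>
  An arrow of the coslice category carries its source and target, because the same underlying arrow
  can commute with the points of different pointed objects.
\<close>

definition coslice ::
  "('o, 'm, 'x) cat_scheme \<Rightarrow> 'o \<Rightarrow> ('o \<times> 'm, ('o \<times> 'm) \<times> 'm \<times> ('o \<times> 'm)) cat" where
  "coslice C a =
    \<lparr> obj = {(v, p). v \<in> obj C \<and> p \<in> hom C a v},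
      arr = {((v, p), f, (w, q)).
               p \<in> hom C a v \<and> q \<in> hom C a w \<and> f \<in> hom C v w \<and> p \<cdot>\<^bsub>C\<^esub> f = q},
      src = (\<lambda>(P, f, Q). P),
      trg = (\<lambda>(P, f, Q). Q),
      ident = (\<lambda>(v, p). ((v, p), \<one>\<^bsub>C\<^esub> v, (v, p))),
      cmp = (\<lambda>(P, f, Q) (Q', g, R). (P, f \<cdot>\<^bsub>C\<^esub> g, R)) \<rparr>"


section \<open>Monoidal categories\<close>

record ('o, 'm) moncat = "('o, 'm) cat" +
  tobj :: "'o \<Rightarrow> 'o \<Rightarrow> 'o" (infixr "\<otimes>\<index>" 70)
  tarr :: "'m \<Rightarrow> 'm \<Rightarrow> 'm" (infixr "\<boxtimes>\<index>" 70)
  unit_obj :: "'o"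
  lunit :: "'o \<Rightarrow> 'm"
  runit :: "'o \<Rightarrow> 'm"
  assoc :: "'o \<Rightarrow> 'o \<Rightarrow> 'o \<Rightarrow> 'm"

locale monoidal_category = category V
  for V :: "('o, 'm, 'x) moncat_scheme" (structure) +
  assumes unit_obj: "unit_obj V \<in> obj V"
    and tensor_functor: "cat_functor (prod_cat V V) V
      \<lparr> fobj = \<lambda>(x, y). x \<otimes> y, farr = \<lambda>(f, g). f \<boxtimes> g \<rparr>"
    and lunit_natural: "natural_isomorphism V V
      \<lparr> fobj = \<lambda>x. unit_obj V \<otimes> x, farr = \<lambda>f. \<one> (unit_obj V) \<boxtimes> f \<rparr>
      \<lparr> fobj = \<lambda>x. x, farr = \<lambda>f. f \<rparr>
      (lunit V)"
    and runit_natural: "natural_isomorphism V V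
      \<lparr> fobj = \<lambda>x. x \<otimes> unit_obj V, farr = \<lambda>f. f \<boxtimes> \<one> (unit_obj V) \<rparr>
      \<lparr> fobj = \<lambda>x. x, farr = \<lambda>f. f \<rparr>
      (runit V)"
    and assoc_natural: "natural_isomorphism (prod_cat (prod_cat V V) V) V
      \<lparr> fobj = \<lambda>((x, y), z). (x \<otimes> y) \<otimes> z, farr = \<lambda>((f, g), h). (f \<boxtimes> g) \<boxtimes> h \<rparr>
      \<lparr> fobj = \<lambda>((x, y), z). x \<otimes> (y \<otimes> z), farr = \<lambda>((f, g), h). f \<boxtimes> (g \<boxtimes> h) \<rparr>
      (\<lambda>((x, y), z). assoc V x y z)"
    and triangle: "\<lbrakk>x \<in> obj V; y \<in> obj V\<rbrakk>
      \<Longrightarrow> assoc V x (unit_obj V) y \<cdot> (\<one> x \<boxtimes> lunit V y) = runit V x \<boxtimes> \<one> y"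
    and pentagon: "\<lbrakk>w \<in> obj V; x \<in> obj V; y \<in> obj V; z \<in> obj V\<rbrakk>
      \<Longrightarrow> (assoc V w x y \<boxtimes> \<one> z) \<cdot> assoc V w (x \<otimes> y) z \<cdot> (\<one> w \<boxtimes> assoc V x y z)
          = assoc V (w \<otimes> x) y z \<cdot> assoc V w x (y \<otimes> z)"

locale V_monoid = monoidal_category V
  for V :: "('o, 'm, 'x) moncat_scheme" (structure) +
  fixes v :: 'o and \<eta> \<mu> :: 'm
  assumes carrier_obj: "v \<in> obj V"
    and unit_hom: "\<eta> \<in> hom V (unit_obj V) v"
    and mult_hom: "\<mu> \<in> hom V (v \<otimes> v) v"
    and left_unit: "(\<eta> \<boxtimes> \<one> v) \<cdot> \<mu> = lunit V v"
    and right_unit: "(\<one> v \<boxtimes> \<eta>) \<cdot> \<mu> = runit V v"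
    and mult_assoc: "(\<mu> \<boxtimes> \<one> v) \<cdot> \<mu> = assoc V v v v \<cdot> (\<one> v \<boxtimes> \<mu>) \<cdot> \<mu>"


section \<open>Pointed tensorial strengths\<close>

definition ptd_unit :: "('o, 'm, 'x) moncat_scheme \<Rightarrow> 'o \<times> 'm" where
  "ptd_unit V = (unit_obj V, \<one>\<^bsub>V\<^esub> (unit_obj V))"

definition ptd_tensor ::
  "('o, 'm, 'x) moncat_scheme \<Rightarrow> 'o \<times> 'm \<Rightarrow> 'o \<times> 'm \<Rightarrow> 'o \<times> 'm" where
  "ptd_tensor V = (\<lambda>(v, p) (w, q).
     (v \<otimes>\<^bsub>V\<^esub> w, inv_arrow V (lunit V (unit_obj V)) \<cdot>\<^bsub>V\<^esub> (p \<boxtimes>\<^bsub>V\<^esub> q)))"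

definition strength_source where
  "strength_source V H =
     \<lparr> fobj = \<lambda>((v, p), x). v \<otimes>\<^bsub>V\<^esub> fobj H x,
       farr = \<lambda>((P, f, Q), g). f \<boxtimes>\<^bsub>V\<^esub> farr H g \<rparr>"

definition strength_target where
  "strength_target V H =
     \<lparr> fobj = \<lambda>((v, p), x). fobj H (v \<otimes>\<^bsub>V\<^esub> x),
       farr = \<lambda>((P, f, Q), g). farr H (f \<boxtimes>\<^bsub>V\<^esub> g) \<rparr>"

locale pointed_strength = monoidal_category V + H: cat_functor V V H
  for V :: "('o, 'm, 'x) moncat_scheme" (structure) and H :: "('o, 'm, 'o, 'm) functor_maps" +
  fixes \<theta> :: "'o \<times> 'm \<Rightarrow> 'o \<Rightarrow> 'm"
  assumes strength_natural:
      "natural_transformation (prod_cat (coslice V (unit_obj V)) V) V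
         (strength_source V H) (strength_target V H) (\<lambda>(P, x). \<theta> P x)"
    and strength_unit: "x \<in> obj V
      \<Longrightarrow> \<theta> (ptd_unit V) x \<cdot> farr H (lunit V x) = lunit V (fobj H x)"
    and strength_tensor:
      "\<lbrakk>(v, p) \<in> obj (coslice V (unit_obj V)); (w, q) \<in> obj (coslice V (unit_obj V));
        x \<in> obj V\<rbrakk>
      \<Longrightarrow> \<theta> (ptd_tensor V (v, p) (w, q)) x \<cdot> farr H (assoc V v w x)
          = assoc V v w (fobj H x) \<cdot> (\<one> v \<boxtimes> \<theta> (w, q) x) \<cdot> \<theta> (v, p) (w \<otimes> x)"


section \<open>Monoidal heterogeneous substitution systems\<close>

definition mhss_solution ::
  "('o, 'm, 'x) moncat_scheme \<Rightarrow> ('o, 'm, 'o, 'm) functor_maps \<Rightarrow> ('o \<times> 'm \<Rightarrow> 'o \<Rightarrow> 'm)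
   \<Rightarrow> 'o \<Rightarrow> 'm \<Rightarrow> 'm \<Rightarrow> 'o \<Rightarrow> 'm \<Rightarrow> 'm \<Rightarrow> 'm \<Rightarrow> bool" where
  "mhss_solution V H \<theta> t \<eta> \<tau> z e f h \<longleftrightarrow>
     h \<in> hom V (z \<otimes>\<^bsub>V\<^esub> t) t \<and>
     (\<one>\<^bsub>V\<^esub> z \<boxtimes>\<^bsub>V\<^esub> \<eta>) \<cdot>\<^bsub>V\<^esub> h = runit V z \<cdot>\<^bsub>V\<^esub> f \<and>
     (\<one>\<^bsub>V\<^esub> z \<boxtimes>\<^bsub>V\<^esub> \<tau>) \<cdot>\<^bsub>V\<^esub> h = \<theta> (z, e) t \<cdot>\<^bsub>V\<^esub> farr H h \<cdot>\<^bsub>V\<^esub> \<tau>"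

locale mhss = pointed_strength V H \<theta>
  for V :: "('o, 'm, 'x) moncat_scheme" (structure)
    and H :: "('o, 'm, 'o, 'm) functor_maps" and \<theta> :: "'o \<times> 'm \<Rightarrow> 'o \<Rightarrow> 'm" +
  fixes t :: 'o and \<eta> \<tau> :: 'm
  assumes carrier_obj: "t \<in> obj V"
    and unit_hom: "\<eta> \<in> hom V (unit_obj V) t"
    and action_hom: "\<tau> \<in> hom V (fobj H t) t"
    and unique_solution: "\<lbrakk>z \<in> obj V; e \<in> hom V (unit_obj V) z; f \<in> hom V z t\<rbrakk>
      \<Longrightarrow> \<exists>!h. mhss_solution V H \<theta> t \<eta> \<tau> z e f h"

definition mhss_morphism ::
  "('o, 'm, 'x) moncat_scheme \<Rightarrow> ('o, 'm, 'o, 'm) functor_maps \<Rightarrow> ('o \<times> 'm \<Rightarrow> 'o \<Rightarrow> 'm)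
   \<Rightarrow> 'o \<Rightarrow> 'm \<Rightarrow> 'm \<Rightarrow> 'o \<Rightarrow> 'm \<Rightarrow> 'm \<Rightarrow> 'm" where
  "mhss_morphism V H \<theta> t \<eta> \<tau> z e f = (THE h. mhss_solution V H \<theta> t \<eta> \<tau> z e f h)"

locale H_theta_monoid = pointed_strength V H \<theta> + V_monoid V v \<eta> \<mu>
  for V :: "('o, 'm, 'x) moncat_scheme" (structure)
    and H :: "('o, 'm, 'o, 'm) functor_maps" and \<theta> :: "'o \<times> 'm \<Rightarrow> 'o \<Rightarrow> 'm"
    and v :: 'o and \<eta> \<mu> :: 'm +
  fixes \<tau> :: 'm
  assumes action_hom: "\<tau> \<in> hom V (fobj H v) v"
    and action_mult: "(\<one> v \<boxtimes> \<tau>) \<cdot> \<mu> = \<theta> (v, \<eta>) v \<cdot> farr H \<mu> \<cdot> \<tau>"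


section \<open>Well-definedness of the constructions\<close>

text \<open>
  The product and coslice constructions are categories, the two pointed objects are in the
  coslice, and the functoriality that the definition of strength asks of its two functors is
  automatic.
\<close>

lemma hom_arr: "f \<in> arr C \<Longrightarrow> f \<in> hom C (src C f) (trg C f)"
  by (simp add: hom_def)

lemma hom_prod_cat: "hom (prod_cat C D) (a, b) (a', b') = hom C a a' \<times> hom D b b'"
  by (auto simp: hom_def prod_cat_def)

lemma hom_coslice:
  "hom (coslice C a) (v, p) (w, q) =
     {((v, p), f, (w, q)) | f. p \<in> hom C a v \<and> q \<in> hom C a w \<and> f \<in> hom C v w \<and> p \<cdot>\<^bsub>C\<^esub> f = q}"
  by (auto simp: hom_def coslice_def)

lemma category_prod_cat:
  assumes "category C" "category D"
  shows "category (prod_cat C D)"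
proof -
  interpret C: category C by fact
  interpret D: category D by fact
  show ?thesis
  proof (unfold_locales, goal_cases)
    case (1 f) then show ?case by (auto simp: prod_cat_def C.src_obj D.src_obj)
  next
    case (2 f) then show ?case by (auto simp: prod_cat_def C.trg_obj D.trg_obj)
  next
    case (3 a) then show ?case
      using C.ident_hom D.ident_hom by (auto simp: prod_cat_def hom_def)
  next
    case (4 f a b g c) then show ?case
      by (cases a; cases b; cases c; cases f; cases g)
         (simp add: hom_prod_cat, simp add: prod_cat_def, blast intro: C.cmp_hom D.cmp_hom)
  next
    case (5 f a b) then show ?case
      by (cases a; cases b; cases f)
         (simp add: hom_prod_cat, simp add: prod_cat_def, blast intro: C.ident_cmp D.ident_cmp)
  next
    case (6 f a b) then show ?case
      by (cases a; cases b; cases f)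
         (simp add: hom_prod_cat, simp add: prod_cat_def, blast intro: C.cmp_ident D.cmp_ident)
  next
    case (7 f a b g c h d) then show ?case
      by (cases a; cases b; cases c; cases d; cases f; cases g; cases h)
         (simp add: hom_prod_cat, simp add: prod_cat_def, blast intro: C.cmp_assoc D.cmp_assoc)
  qed
qed

lemma category_coslice:
  assumes "category C"
  shows "category (coslice C a)"
proof -
  interpret C: category C by fact
  have ob: "b \<in> obj C \<and> c \<in> obj C" if "f \<in> hom C b c" for f b c
    using that C.src_obj C.trg_obj by (auto simp: hom_def)
  show ?thesis
  proof (unfold_locales, goal_cases)
    case (1 f) then show ?case by (auto simp: coslice_def dest: ob)
  next
    case (2 f) then show ?case by (auto simp: coslice_def dest: ob)
  next
    case (3 x) then show ?case
      by (cases x) (auto simp: hom_coslice, auto simp: coslice_def C.cmp_ident C.ident_hom)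
  next
    case (4 f x y g z) then show ?case
      by (cases x; cases y; cases z)
         (auto simp: hom_coslice, auto simp: coslice_def C.cmp_assoc intro: C.cmp_hom)
  next
    case (5 f x y) then show ?case
      by (cases x; cases y) (auto simp: hom_coslice, auto simp: coslice_def C.ident_cmp)
  next
    case (6 f x y) then show ?case
      by (cases x; cases y) (auto simp: hom_coslice, auto simp: coslice_def C.cmp_ident)
  next
    case (7 f x y g z h w) then show ?case
      by (cases x; cases y; cases z; cases w)
         (auto simp: hom_coslice, auto simp: coslice_def C.cmp_assoc)
  qed
qed

context monoidal_category
begin

lemma tobj_obj: "\<lbrakk>x \<in> obj V; y \<in> obj V\<rbrakk> \<Longrightarrow> x \<otimes> y \<in> obj V"
  using cat_functor.fobj_obj[OF tensor_functor, of "(x, y)"] by (simp add: prod_cat_def)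

lemma tarr_hom:
  "\<lbrakk>f \<in> hom V a b; g \<in> hom V c d\<rbrakk> \<Longrightarrow> f \<boxtimes> g \<in> hom V (a \<otimes> c) (b \<otimes> d)"
  using cat_functor.farr_hom[OF tensor_functor, of "(f, g)" "(a, c)" "(b, d)"]
  by (simp add: hom_prod_cat)

lemma tarr_ident: "\<lbrakk>x \<in> obj V; y \<in> obj V\<rbrakk> \<Longrightarrow> \<one> x \<boxtimes> \<one> y = \<one> (x \<otimes> y)"
  using cat_functor.farr_ident[OF tensor_functor, of "(x, y)"] by (simp add: prod_cat_def)

lemma tarr_cmp:
  "\<lbrakk>f \<in> hom V a b; f' \<in> hom V b c; g \<in> hom V x y; g' \<in> hom V y z\<rbrakk>
   \<Longrightarrow> (f \<cdot> f') \<boxtimes> (g \<cdot> g') = (f \<boxtimes> g) \<cdot> (f' \<boxtimes> g')"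
  using cat_functor.farr_cmp[OF tensor_functor, of "(f, g)" "(a, x)" "(b, y)" "(f', g')" "(c, z)"]
  by (simp add: hom_prod_cat) (simp add: prod_cat_def)

lemma inverse_arrows_unique:
  assumes "inverse_arrows V f g" "inverse_arrows V f g'"
  shows "g = g'"
proof -
  have f: "f \<in> hom V (src V f) (trg V f)" and g: "g \<in> hom V (trg V f) (src V f)"
    and g': "g' \<in> hom V (trg V f) (src V f)"
    using assms by (auto simp: inverse_arrows_def hom_arr)
  have "g = g \<cdot> (f \<cdot> g')" using assms(2) cmp_ident[OF g] by (simp add: inverse_arrows_def)
  also have "\<dots> = (g \<cdot> f) \<cdot> g'" using cmp_assoc[OF g f g'] by simp
  also have "\<dots> = g'" using assms(1) ident_cmp[OF g'] by (simp add: inverse_arrows_def)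
  finally show ?thesis .
qed

lemma inv_arrow: "iso_arrow V f \<Longrightarrow> inverse_arrows V f (inv_arrow V f)"
  unfolding iso_arrow_def inv_arrow_def by (metis inverse_arrows_unique the_equality)

lemma ptd_unit_obj: "ptd_unit V \<in> obj (coslice V (unit_obj V))"
  by (simp add: ptd_unit_def coslice_def unit_obj ident_hom)

lemma ptd_tensor_obj:
  assumes "P \<in> obj (coslice V (unit_obj V))" "Q \<in> obj (coslice V (unit_obj V))"
  shows "ptd_tensor V P Q \<in> obj (coslice V (unit_obj V))"
proof -
  obtain v p w q where PQ: "P = (v, p)" "Q = (w, q)" by (cases P; cases Q)
  interpret L: natural_isomorphism V V
    "\<lparr> fobj = \<lambda>x. unit_obj V \<otimes> x, farr = \<lambda>f. \<one> (unit_obj V) \<boxtimes> f \<rparr>"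
    "\<lparr> fobj = \<lambda>x. x, farr = \<lambda>f. f \<rparr>" "lunit V"
    by (rule lunit_natural)
  have l: "lunit V (unit_obj V) \<in> hom V (unit_obj V \<otimes> unit_obj V) (unit_obj V)"
    using L.component_hom[OF unit_obj] by simp
  have "inv_arrow V (lunit V (unit_obj V)) \<in> hom V (unit_obj V) (unit_obj V \<otimes> unit_obj V)"
    using inv_arrow[OF L.component_iso[OF unit_obj]] l by (auto simp: inverse_arrows_def hom_def)
  then show ?thesis
    using assms by (auto simp: PQ ptd_tensor_def coslice_def intro: tobj_obj cmp_hom tarr_hom)
qed

lemma strength_functors:
  assumes "cat_functor V V H"
  shows "cat_functor (prod_cat (coslice V (unit_obj V)) V) V (strength_source V H)"
    and "cat_functor (prod_cat (coslice V (unit_obj V)) V) V (strength_target V H)"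
proof -
  interpret H: cat_functor V V H by fact
  interpret P: category "prod_cat (coslice V (unit_obj V)) V"
    by (intro category_prod_cat category_coslice category_axioms)
  show "cat_functor (prod_cat (coslice V (unit_obj V)) V) V (strength_source V H)"
  proof (unfold_locales, goal_cases)
    case (1 a) then show ?case
      by (auto simp: prod_cat_def coslice_def strength_source_def intro: tobj_obj H.fobj_obj)
  next
    case (2 f a b) then show ?case
      by (cases a; cases b; cases "fst a"; cases "fst b")
         (auto simp: hom_prod_cat hom_coslice strength_source_def intro: tarr_hom H.farr_hom)
  next
    case (3 a) then show ?case
      by (auto simp: prod_cat_def coslice_def strength_source_def H.farr_ident tarr_ident
          H.fobj_obj)
  next
    case (4 f a b g c) then show ?case
      by (cases a; cases b; cases c; cases "fst a"; cases "fst b"; cases "fst c")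
         (auto simp: hom_prod_cat hom_coslice,
          auto simp: prod_cat_def coslice_def strength_source_def H.farr_cmp
            intro!: tarr_cmp H.farr_hom)
  qed
  show "cat_functor (prod_cat (coslice V (unit_obj V)) V) V (strength_target V H)"
  proof (unfold_locales, goal_cases)
    case (1 a) then show ?case
      by (auto simp: prod_cat_def coslice_def strength_target_def intro: tobj_obj H.fobj_obj)
  next
    case (2 f a b) then show ?case
      by (cases a; cases b; cases "fst a"; cases "fst b")
         (auto simp: hom_prod_cat hom_coslice strength_target_def intro: tarr_hom H.farr_hom)
  next
    case (3 a) then show ?case
      by (auto simp: prod_cat_def coslice_def strength_target_def tarr_ident tobj_obj
          H.farr_ident)
  next
    case (4 f a b g c) then show ?case
      by (cases a; cases b; cases c; cases "fst a"; cases "fst b"; cases "fst c")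
         (auto simp: hom_prod_cat hom_coslice,
          auto simp: prod_cat_def coslice_def strength_target_def tarr_cmp
            intro!: H.farr_cmp tarr_hom)
  qed
qed

end

end

theory Submission
  imports Defs
begin

text \<open>
  Every monoid law follows from uniqueness in the substitution system. The right unit law and
  compatibility with \<open>\<tau>\<close> are the two equations defining \<open>\<mu>\<close>. Both sides of the left unit law solve
  the problem for \<open>(I, 1, \<eta>)\<close>. Hence \<open>\<mu>\<close> is a morphism of pointed objects from
  \<open>(t, \<eta>) \<otimes> (t, \<eta>)\<close> to \<open>(t, \<eta>)\<close>, so that naturality of the strength applies to it, and both sides
  of associativity solve the problem for \<open>t \<otimes> t\<close> with that point and \<open>f = \<mu>\<close>. These arguments use
  Kelly's redundant coherence laws \<open>\<alpha>\<^bsub>x,y,I\<^esub> \<cdot> (1 \<otimes> \<rho>\<^bsub>y\<^esub>) = \<rho>\<^bsub>x\<otimes>y\<^esub>\<close> and \<open>\<lambda>\<^bsub>I\<^esub> = \<rho>\<^bsub>I\<^esub>\<close>.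
\<close>

section \<open>Source-target typing and cancellation of isomorphisms in a category\<close>

lemma hom_iff: "f \<in> hom C a b \<longleftrightarrow> f \<in> arr C \<and> src C f = a \<and> trg C f = b"
  by (simp add: hom_def)

text \<open>
  Typing conditions are phrased with \<open>src\<close> and \<open>trg\<close> instead of \<open>hom\<close>, so that the simplifier meets
  no unknown objects when it discharges them.
\<close>

context category
begin

lemma ident_arr [simp]:
  assumes "a \<in> obj C"
  shows "\<one> a \<in> arr C" "src C (\<one> a) = a" "trg C (\<one> a) = a"
  using ident_hom[OF assms] by (simp_all add: hom_iff)

lemma cmp_arr [simp]:
  assumes "f \<in> arr C" "g \<in> arr C" "trg C f = src C g"
  shows "f \<cdot> g \<in> arr C" "src C (f \<cdot> g) = src C f" "trg C (f \<cdot> g) = trg C g"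
  using cmp_hom[of f "src C f" "src C g" g "trg C g"] assms by (simp_all add: hom_iff)

text \<open>Kept out of the simp set because it serves in both directions: nesting to the right by
  default, and flipped where a pair on the left has to be fused.\<close>

lemma cmp_assoc_arr:
  assumes "f \<in> arr C" "g \<in> arr C" "h \<in> arr C" "trg C f = src C g" "trg C g = src C h"
  shows "(f \<cdot> g) \<cdot> h = f \<cdot> (g \<cdot> h)"
  using assms by (intro cmp_assoc) (auto simp: hom_iff)

lemma ident_cmp_arr [simp]: "\<lbrakk>f \<in> arr C; src C f = a\<rbrakk> \<Longrightarrow> \<one> a \<cdot> f = f"
  by (rule ident_cmp) (simp add: hom_iff)

lemma cmp_ident_arr [simp]: "\<lbrakk>f \<in> arr C; trg C f = a\<rbrakk> \<Longrightarrow> f \<cdot> \<one> a = f"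
  by (rule cmp_ident) (simp add: hom_iff)

lemma iso_cancel_left:
  assumes f: "iso_arrow C f"
    and gh: "g \<in> arr C" "h \<in> arr C" "src C g = trg C f" "src C h = trg C f"
    and eq: "f \<cdot> g = f \<cdot> h"
  shows "g = h"
proof -
  obtain f' where f': "f \<in> arr C" "f' \<in> arr C" "trg C f' = src C f" "src C f' = trg C f"
      "f' \<cdot> f = \<one> (trg C f)"
    using f by (auto simp: iso_arrow_def inverse_arrows_def hom_iff)
  have "g = (f' \<cdot> f) \<cdot> g" using f' gh by simp
  also have "\<dots> = (f' \<cdot> f) \<cdot> h" using f'(1-4) gh eq by (simp add: cmp_assoc_arr)
  also have "\<dots> = h" using f' gh by simp
  finally show ?thesis .
qed

lemma iso_cancel_right:
  assumes f: "iso_arrow C f"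
    and gh: "g \<in> arr C" "h \<in> arr C" "trg C g = src C f" "trg C h = src C f"
    and eq: "g \<cdot> f = h \<cdot> f"
  shows "g = h"
proof -
  obtain f' where f': "f \<in> arr C" "f' \<in> arr C" "trg C f' = src C f" "src C f' = trg C f"
      "f \<cdot> f' = \<one> (src C f)"
    using f by (auto simp: iso_arrow_def inverse_arrows_def hom_iff)
  have "g = g \<cdot> (f \<cdot> f')" using f' gh by simp
  also have "\<dots> = h \<cdot> (f \<cdot> f')" using f'(1-4) gh eq by (simp flip: cmp_assoc_arr)
  also have "\<dots> = h" using f' gh by simp
  finally show ?thesis .
qed

end

section \<open>Bifunctoriality, naturality and Kelly's coherence laws\<close>

context monoidal_category
begin

declare unit_obj [simp] tobj_obj [simp]

abbreviation "I \<equiv> unit_obj V"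

lemma tarr_arr [simp]:
  assumes "f \<in> arr V" "g \<in> arr V"
  shows "f \<boxtimes> g \<in> arr V" "src V (f \<boxtimes> g) = src V f \<otimes> src V g"
    "trg V (f \<boxtimes> g) = trg V f \<otimes> trg V g"
  using tarr_hom[OF hom_arr hom_arr, OF assms] by (simp_all add: hom_iff)

lemma interchange:
  "\<lbrakk>f \<in> arr V; f' \<in> arr V; g \<in> arr V; g' \<in> arr V; trg V f = src V f'; trg V g = src V g'\<rbrakk>
   \<Longrightarrow> (f \<boxtimes> g) \<cdot> (f' \<boxtimes> g') = (f \<cdot> f') \<boxtimes> (g \<cdot> g')"
  by (rule tarr_cmp[symmetric]) (auto simp: hom_iff)

text \<open>By interchange both sides equal \<open>f \<boxtimes> g\<close>. This moves a map of the
  left factor past \<open>\<eta>\<close> or \<open>\<tau>\<close> in the right factor.\<close>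

lemma slide:
  assumes "f \<in> arr V" "g \<in> arr V" "src V f = a" "trg V f = b" "src V g = c" "trg V g = d"
  shows "(\<one> a \<boxtimes> g) \<cdot> (f \<boxtimes> \<one> d) = (f \<boxtimes> \<one> c) \<cdot> (\<one> b \<boxtimes> g)"
proof -
  have "a \<in> obj V" "b \<in> obj V" "c \<in> obj V" "d \<in> obj V"
    using assms src_obj trg_obj by auto
  then show ?thesis using assms by (simp add: interchange)
qed

lemma lunit_iso:
  assumes "x \<in> obj V"
  shows "iso_arrow V (lunit V x)"
  using natural_isomorphism.component_iso[OF lunit_natural assms] .

lemma lunit_arr [simp]:
  assumes "x \<in> obj V"
  shows "lunit V x \<in> arr V" "src V (lunit V x) = I \<otimes> x" "trg V (lunit V x) = x"
  using natural_transformation.component_hom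
    [OF natural_isomorphism.axioms(1)[OF lunit_natural] assms]
  by (simp_all add: hom_iff)

lemma lunit_naturality:
  assumes "f \<in> arr V" "src V f = a" "trg V f = b"
  shows "(\<one> I \<boxtimes> f) \<cdot> lunit V b = lunit V a \<cdot> f"
  using natural_transformation.naturality
    [OF natural_isomorphism.axioms(1)[OF lunit_natural], of f a b] assms
  by (simp add: hom_iff)

lemma runit_iso:
  assumes "x \<in> obj V"
  shows "iso_arrow V (runit V x)"
  using natural_isomorphism.component_iso[OF runit_natural assms] .

lemma runit_arr [simp]:
  assumes "x \<in> obj V"
  shows "runit V x \<in> arr V" "src V (runit V x) = x \<otimes> I" "trg V (runit V x) = x"
  using natural_transformation.component_hom
    [OF natural_isomorphism.axioms(1)[OF runit_natural] assms]
  by (simp_all add: hom_iff)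

lemma runit_naturality:
  assumes "f \<in> arr V" "src V f = a" "trg V f = b"
  shows "(f \<boxtimes> \<one> I) \<cdot> runit V b = runit V a \<cdot> f"
  using natural_transformation.naturality
    [OF natural_isomorphism.axioms(1)[OF runit_natural], of f a b] assms
  by (simp add: hom_iff)

lemma assoc_iso:
  assumes "x \<in> obj V" "y \<in> obj V" "z \<in> obj V"
  shows "iso_arrow V (assoc V x y z)"
  using natural_isomorphism.component_iso[OF assoc_natural, of "((x, y), z)"] assms
  by (simp add: prod_cat_def)

lemma assoc_arr [simp]:
  assumes "x \<in> obj V" "y \<in> obj V" "z \<in> obj V"
  shows "assoc V x y z \<in> arr V" "src V (assoc V x y z) = (x \<otimes> y) \<otimes> z"
    "trg V (assoc V x y z) = x \<otimes> (y \<otimes> z)"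
  using natural_transformation.component_hom
    [OF natural_isomorphism.axioms(1)[OF assoc_natural], of "((x, y), z)"] assms
  by (simp_all add: hom_iff prod_cat_def)

lemma assoc_naturality:
  assumes "f \<in> arr V" "src V f = a" "trg V f = a'"
    and "g \<in> arr V" "src V g = b" "trg V g = b'"
    and "h \<in> arr V" "src V h = c" "trg V h = c'"
  shows "((f \<boxtimes> g) \<boxtimes> h) \<cdot> assoc V a' b' c' = assoc V a b c \<cdot> (f \<boxtimes> (g \<boxtimes> h))"
  using natural_transformation.naturality
    [OF natural_isomorphism.axioms(1)[OF assoc_natural],
      of "((f, g), h)" "((a, b), c)" "((a', b'), c')"] assms
  by (simp add: hom_prod_cat hom_iff)

text \<open>Naturality of \<open>lunit\<close> expresses \<open>lunit V (src V f) \<cdot> f\<close>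
  through \<open>\<one> I \<boxtimes> f\<close>, and the unitor can then be cancelled.\<close>

lemma tensor_unit_left_faithful:
  assumes "f \<in> arr V" "g \<in> arr V" "src V f = src V g" "trg V f = trg V g"
    and eq: "\<one> I \<boxtimes> f = \<one> I \<boxtimes> g"
  shows "f = g"
proof (rule iso_cancel_left)
  show "iso_arrow V (lunit V (src V f))"
    using assms src_obj by (simp add: lunit_iso)
  show "lunit V (src V f) \<cdot> f = lunit V (src V f) \<cdot> g"
    using assms lunit_naturality[of f] lunit_naturality[of g] by simp
qed (use assms src_obj in auto)

lemma tensor_unit_right_faithful:
  assumes "f \<in> arr V" "g \<in> arr V" "src V f = src V g" "trg V f = trg V g"
    and eq: "f \<boxtimes> \<one> I = g \<boxtimes> \<one> I"
  shows "f = g"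
proof (rule iso_cancel_left)
  show "iso_arrow V (runit V (src V f))"
    using assms src_obj by (simp add: runit_iso)
  show "runit V (src V f) \<cdot> f = runit V (src V f) \<cdot> g"
    using assms runit_naturality[of f] runit_naturality[of g] by simp
qed (use assms src_obj in auto)

text \<open>Tensor the claim with \<open>I\<close> on the right and compose with an associator. The
  triangle at \<open>y, I\<close>, the pentagon at \<open>x, y, I, I\<close> and the triangle at
  \<open>x \<otimes> y, I\<close> then identify the two sides. The associator is cancelled, and
  tensoring with \<open>I\<close> is faithful.\<close>

lemma assoc_runit:
  assumes x [simp]: "x \<in> obj V" and y [simp]: "y \<in> obj V"
  shows "assoc V x y I \<cdot> (\<one> x \<boxtimes> runit V y) = runit V (x \<otimes> y)"
proof -
  let ?a = "assoc V x y I" and ?l = "\<one> x \<boxtimes> (\<one> y \<boxtimes> lunit V I)"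
  have "((?a \<cdot> (\<one> x \<boxtimes> runit V y)) \<boxtimes> \<one> I) \<cdot> ?a
      = (?a \<boxtimes> \<one> I) \<cdot> (((\<one> x \<boxtimes> runit V y) \<boxtimes> \<one> I) \<cdot> ?a)"
    by (simp add: interchange flip: cmp_assoc_arr)
  also have "\<dots> = (?a \<boxtimes> \<one> I) \<cdot> (assoc V x (y \<otimes> I) I \<cdot> (\<one> x \<boxtimes> (runit V y \<boxtimes> \<one> I)))"
    by (simp add: assoc_naturality)
  also have "\<dots> = (?a \<boxtimes> \<one> I) \<cdot> (assoc V x (y \<otimes> I) I \<cdot> ((\<one> x \<boxtimes> assoc V y I I) \<cdot> ?l))"
    by (simp add: interchange triangle)
  also have "\<dots> = ((?a \<boxtimes> \<one> I) \<cdot> assoc V x (y \<otimes> I) I \<cdot> (\<one> x \<boxtimes> assoc V y I I)) \<cdot> ?l"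
    by (simp add: cmp_assoc_arr)
  also have "\<dots> = assoc V (x \<otimes> y) I I \<cdot> (assoc V x y (I \<otimes> I) \<cdot> ?l)"
    by (simp only: pentagon[OF x y unit_obj unit_obj]) (simp add: cmp_assoc_arr)
  also have "\<dots> = assoc V (x \<otimes> y) I I \<cdot> ((\<one> (x \<otimes> y) \<boxtimes> lunit V I) \<cdot> ?a)"
    by (simp add: tarr_ident flip: assoc_naturality)
  also have "\<dots> = (runit V (x \<otimes> y) \<boxtimes> \<one> I) \<cdot> ?a"
    by (simp add: triangle flip: cmp_assoc_arr)
  finally have "(?a \<cdot> (\<one> x \<boxtimes> runit V y)) \<boxtimes> \<one> I = runit V (x \<otimes> y) \<boxtimes> \<one> I"
    by (rule iso_cancel_right[OF assoc_iso, rotated -1]) simp_all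
  then show ?thesis
    by (rule tensor_unit_right_faithful[rotated -1]) simp_all
qed

lemma lunit_unit_eq_runit_unit: "lunit V I = runit V I"
proof -
  \<comment> \<open>This is naturality of \<open>runit\<close> at the arrow \<open>runit V I\<close>
    itself, followed by cancelling \<open>runit V I\<close> on the right.\<close>
  have "runit V I \<boxtimes> \<one> I = runit V (I \<otimes> I)"
    by (rule iso_cancel_right[OF runit_iso[of I]]) (simp_all add: runit_naturality)
  \<comment> \<open>The left side is \<open>runit V I \<boxtimes> \<one> I\<close> by the triangle,
    the right side \<open>runit V (I \<otimes> I)\<close> by \<open>assoc_runit\<close>.\<close>
  then have "assoc V I I I \<cdot> (\<one> I \<boxtimes> lunit V I) = assoc V I I I \<cdot> (\<one> I \<boxtimes> runit V I)"
    by (simp add: triangle assoc_runit)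
  then have "\<one> I \<boxtimes> lunit V I = \<one> I \<boxtimes> runit V I"
    by (rule iso_cancel_left[OF assoc_iso, rotated -1]) simp_all
  then show ?thesis
    by (rule tensor_unit_left_faithful[rotated -1]) simp_all
qed

end

section \<open>Functors and strengths on arrows\<close>

context cat_functor
begin

lemma farr_arr [simp]:
  assumes "f \<in> arr C"
  shows "farr F f \<in> arr D" "src D (farr F f) = fobj F (src C f)"
    "trg D (farr F f) = fobj F (trg C f)"
  using farr_hom[OF hom_arr, OF assms] by (simp_all add: hom_iff)

lemma farr_cmp_arr:
  "\<lbrakk>f \<in> arr C; g \<in> arr C; trg C f = src C g\<rbrakk>
   \<Longrightarrow> farr F (f \<cdot>\<^bsub>C\<^esub> g) = farr F f \<cdot>\<^bsub>D\<^esub> farr F g"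
  by (rule farr_cmp) (auto simp: hom_iff)

end

context pointed_strength
begin

declare H.fobj_obj [simp]

lemma strength_arr [simp]:
  assumes "p \<in> hom V I v" "x \<in> obj V"
  shows "\<theta> (v, p) x \<in> arr V" "src V (\<theta> (v, p) x) = v \<otimes> fobj H x"
    "trg V (\<theta> (v, p) x) = fobj H (v \<otimes> x)"
proof -
  have "v \<in> obj V" using assms trg_obj by (auto simp: hom_iff)
  then show "\<theta> (v, p) x \<in> arr V" "src V (\<theta> (v, p) x) = v \<otimes> fobj H x"
    "trg V (\<theta> (v, p) x) = fobj H (v \<otimes> x)"
    using natural_transformation.component_hom[OF strength_natural, of "((v, p), x)"] assms
    by (simp_all add: prod_cat_def coslice_def strength_source_def strength_target_def hom_iff)
qed

text \<open>The hypothesis \<open>p \<cdot> f = q\<close> makes \<open>f\<close> an arrow of the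
  coslice, so naturality in both arguments is available at once.\<close>

lemma strength_naturality:
  assumes "p \<in> hom V I v" "q \<in> hom V I w" "f \<in> hom V v w" "p \<cdot> f = q" "g \<in> hom V x y"
  shows "(f \<boxtimes> farr H g) \<cdot> \<theta> (w, q) y = \<theta> (v, p) x \<cdot> farr H (f \<boxtimes> g)"
  using natural_transformation.naturality[OF strength_natural,
      of "(((v, p), f, (w, q)), g)" "((v, p), x)" "((w, q), y)"] assms
  by (simp add: hom_prod_cat hom_coslice strength_source_def strength_target_def)

end

section \<open>Monoid laws from uniqueness of solutions\<close>

context mhss
begin

definition mult :: 'm where
  "mult = mhss_morphism V H \<theta> t \<eta> \<tau> t \<eta> (\<one> t)"

lemma solution_unique:
  assumes "e \<in> hom V I z" "f \<in> hom V z t"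
    and "mhss_solution V H \<theta> t \<eta> \<tau> z e f h" "mhss_solution V H \<theta> t \<eta> \<tau> z e f h'"
  shows "h = h'"
proof -
  have "z \<in> obj V" using assms(1) trg_obj by (auto simp: hom_iff)
  with assms unique_solution show ?thesis by blast
qed

lemma mult_solution: "mhss_solution V H \<theta> t \<eta> \<tau> t \<eta> (\<one> t) mult"
  unfolding mult_def mhss_morphism_def
  by (rule theI', rule unique_solution[OF carrier_obj unit_hom ident_hom[OF carrier_obj]])

lemma carrier_arr [simp]:
  "t \<in> obj V"
  "\<eta> \<in> arr V" "src V \<eta> = I" "trg V \<eta> = t"
  "\<tau> \<in> arr V" "src V \<tau> = fobj H t" "trg V \<tau> = t"
  "mult \<in> arr V" "src V mult = t \<otimes> t" "trg V mult = t"
  using carrier_obj unit_hom action_hom mult_solution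
  by (simp_all add: mhss_solution_def hom_iff)

lemma mult_right_unit: "(\<one> t \<boxtimes> \<eta>) \<cdot> mult = runit V t"
  using mult_solution by (simp add: mhss_solution_def)

lemma mult_action: "(\<one> t \<boxtimes> \<tau>) \<cdot> mult = \<theta> (t, \<eta>) t \<cdot> (farr H mult \<cdot> \<tau>)"
  using mult_solution unit_hom by (simp add: mhss_solution_def cmp_assoc_arr)

text \<open>When \<open>f\<close> is a morphism of pointed objects, the solution is explicit: slide
  \<open>f\<close> past \<open>\<eta>\<close> or \<open>\<tau>\<close> and use the equations of
  \<open>mult\<close>. It is applied below with \<open>f = \<eta>\<close> and with
  \<open>f = mult\<close>.\<close>

lemma pointed_cmp_mult_solution:
  assumes e: "e \<in> hom V I z" and f: "f \<in> hom V z t" and ef: "e \<cdot> f = \<eta>"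
  shows "mhss_solution V H \<theta> t \<eta> \<tau> z e f ((f \<boxtimes> \<one> t) \<cdot> mult)"
proof -
  have [simp]: "z \<in> obj V" "f \<in> arr V" "src V f = z" "trg V f = t"
    using f src_obj by (auto simp: hom_iff)
  note [simp] = e unit_hom
  have "(\<one> z \<boxtimes> \<eta>) \<cdot> ((f \<boxtimes> \<one> t) \<cdot> mult) = ((\<one> z \<boxtimes> \<eta>) \<cdot> (f \<boxtimes> \<one> t)) \<cdot> mult"
    by (simp add: cmp_assoc_arr)
  also have "\<dots> = (f \<boxtimes> \<one> I) \<cdot> ((\<one> t \<boxtimes> \<eta>) \<cdot> mult)"
    by (simp add: slide[where b = t and c = I] cmp_assoc_arr)
  also have "\<dots> = runit V z \<cdot> f"
    by (simp add: mult_right_unit runit_naturality)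
  finally have unit: "(\<one> z \<boxtimes> \<eta>) \<cdot> ((f \<boxtimes> \<one> t) \<cdot> mult) = runit V z \<cdot> f" .
  \<comment> \<open>Here \<open>ef\<close> is essential: it lets naturality exchange the point
    \<open>\<eta>\<close> of \<open>t\<close> for the point \<open>e\<close> of
    \<open>z\<close>.\<close>
  have nat: "(f \<boxtimes> \<one> (fobj H t)) \<cdot> \<theta> (t, \<eta>) t = \<theta> (z, e) t \<cdot> farr H (f \<boxtimes> \<one> t)"
    using strength_naturality[OF e unit_hom f ef ident_hom[of t]] by (simp add: H.farr_ident)
  have "(\<one> z \<boxtimes> \<tau>) \<cdot> ((f \<boxtimes> \<one> t) \<cdot> mult) = ((\<one> z \<boxtimes> \<tau>) \<cdot> (f \<boxtimes> \<one> t)) \<cdot> mult"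
    by (simp add: cmp_assoc_arr)
  also have "\<dots> = (f \<boxtimes> \<one> (fobj H t)) \<cdot> ((\<one> t \<boxtimes> \<tau>) \<cdot> mult)"
    by (simp add: slide[where b = t and c = "fobj H t"] cmp_assoc_arr)
  also have "\<dots> = ((f \<boxtimes> \<one> (fobj H t)) \<cdot> \<theta> (t, \<eta>) t) \<cdot> (farr H mult \<cdot> \<tau>)"
    by (simp add: mult_action cmp_assoc_arr)
  also have "\<dots> = \<theta> (z, e) t \<cdot> farr H ((f \<boxtimes> \<one> t) \<cdot> mult) \<cdot> \<tau>"
    unfolding nat by (simp add: H.farr_cmp_arr cmp_assoc_arr)
  finally show ?thesis
    using unit by (simp add: mhss_solution_def hom_iff)
qed

lemma mult_left_unit: "(\<eta> \<boxtimes> \<one> t) \<cdot> mult = lunit V t"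
proof (rule solution_unique)
  show "mhss_solution V H \<theta> t \<eta> \<tau> I (\<one> I) \<eta> ((\<eta> \<boxtimes> \<one> t) \<cdot> mult)"
    by (rule pointed_cmp_mult_solution) (simp_all add: hom_iff)
  \<comment> \<open>With this, naturality of \<open>lunit\<close> at \<open>\<tau>\<close> gives the
    second equation for \<open>lunit V t\<close>. The first is naturality at \<open>\<eta>\<close>,
    where \<open>lunit V I\<close> has to be replaced by \<open>runit V I\<close>.\<close>
  have "\<theta> (I, \<one> I) t \<cdot> farr H (lunit V t) = lunit V (fobj H t)"
    using strength_unit[of t] by (simp add: ptd_unit_def)
  then show "mhss_solution V H \<theta> t \<eta> \<tau> I (\<one> I) \<eta> (lunit V t)"
    by (simp add: mhss_solution_def hom_iff lunit_naturality[of _ _ t] lunit_unit_eq_runit_unit)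
qed (simp_all add: hom_iff)

lemma mult_associative:
  "(mult \<boxtimes> \<one> t) \<cdot> mult = assoc V t t t \<cdot> (\<one> t \<boxtimes> mult) \<cdot> mult"
proof -
  note [simp] = unit_hom
  let ?l = "lunit V I" and ?a = "assoc V t t t"
  \<comment> \<open>The point of the pointed tensor square of \<open>(t, \<eta>)\<close>.\<close>
  define e where "e = inv_arrow V ?l \<cdot> (\<eta> \<boxtimes> \<eta>)"
  have inv: "inv_arrow V ?l \<in> arr V" "src V (inv_arrow V ?l) = I"
    "trg V (inv_arrow V ?l) = I \<otimes> I" "inv_arrow V ?l \<cdot> ?l = \<one> I"
    using inv_arrow[OF lunit_iso[of I]] by (auto simp: inverse_arrows_def hom_iff)
  have e: "e \<in> hom V I (t \<otimes> t)"
    by (simp add: e_def inv hom_iff)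
  note [simp] = e
  have pt: "ptd_tensor V (t, \<eta>) (t, \<eta>) = (t \<otimes> t, e)"
    by (simp add: ptd_tensor_def e_def)
  \<comment> \<open>Splitting \<open>\<eta> \<boxtimes> \<eta>\<close> into one factor at a time
    exposes the left unit law.\<close>
  have "(\<eta> \<boxtimes> \<eta>) \<cdot> mult = (\<one> I \<boxtimes> \<eta>) \<cdot> ((\<eta> \<boxtimes> \<one> t) \<cdot> mult)"
    by (simp add: interchange flip: cmp_assoc_arr)
  also have "\<dots> = ?l \<cdot> \<eta>"
    by (simp add: mult_left_unit lunit_naturality)
  finally have "e \<cdot> mult = (inv_arrow V ?l \<cdot> ?l) \<cdot> \<eta>"
    unfolding e_def by (simp add: inv(1-3) cmp_assoc_arr)
  then have e_mult: "e \<cdot> mult = \<eta>"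
    by (simp add: inv)

  \<comment> \<open>The identity of \<open>t \<otimes> t\<close> is split as a tensor so that the
    associator can move past \<open>\<eta>\<close>.\<close>
  have "(\<one> (t \<otimes> t) \<boxtimes> \<eta>) \<cdot> (?a \<cdot> ((\<one> t \<boxtimes> mult) \<cdot> mult))
      = (((\<one> t \<boxtimes> \<one> t) \<boxtimes> \<eta>) \<cdot> ?a) \<cdot> ((\<one> t \<boxtimes> mult) \<cdot> mult)"
    by (simp add: tarr_ident cmp_assoc_arr)
  also have "\<dots> = assoc V t t I \<cdot> (((\<one> t \<boxtimes> (\<one> t \<boxtimes> \<eta>)) \<cdot> (\<one> t \<boxtimes> mult)) \<cdot> mult)"
    by (simp add: assoc_naturality[where a = t and b = t and c = I] cmp_assoc_arr)
  also have "\<dots> = (assoc V t t I \<cdot> (\<one> t \<boxtimes> runit V t)) \<cdot> mult"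
    by (simp add: interchange mult_right_unit cmp_assoc_arr)
  also have "\<dots> = runit V (t \<otimes> t) \<cdot> mult"
    by (simp add: assoc_runit)
  finally have unit: "(\<one> (t \<otimes> t) \<boxtimes> \<eta>) \<cdot> (?a \<cdot> ((\<one> t \<boxtimes> mult) \<cdot> mult))
      = runit V (t \<otimes> t) \<cdot> mult" .

  \<comment> \<open>Naturality in the second argument only: the pointed object stays
    \<open>(t, \<eta>)\<close>.\<close>
  have nat: "(\<one> t \<boxtimes> farr H mult) \<cdot> \<theta> (t, \<eta>) t = \<theta> (t, \<eta>) (t \<otimes> t) \<cdot> farr H (\<one> t \<boxtimes> mult)"
    by (rule strength_naturality) (simp_all add: hom_iff)
  have tensor: "\<theta> (t \<otimes> t, e) t \<cdot> farr H ?a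
      = assoc V t t (fobj H t) \<cdot> ((\<one> t \<boxtimes> \<theta> (t, \<eta>) t) \<cdot> \<theta> (t, \<eta>) (t \<otimes> t))"
    using strength_tensor[of t \<eta> t \<eta> t] by (simp add: coslice_def pt cmp_assoc_arr)
  have split: "\<one> t \<boxtimes> ((\<one> t \<boxtimes> \<tau>) \<cdot> mult)
      = (\<one> t \<boxtimes> \<theta> (t, \<eta>) t) \<cdot> ((\<one> t \<boxtimes> farr H mult) \<cdot> (\<one> t \<boxtimes> \<tau>))"
    by (simp add: interchange mult_action)
  \<comment> \<open>The equation \<open>mult_action\<close> is used twice, first under
    \<open>\<one> t \<boxtimes> _\<close> through \<open>split\<close>, then on the outer
    \<open>mult\<close>. Between the two resulting strengths stands \<open>farr H mult\<close>;
    \<open>nat\<close> moves it out, and \<open>tensor\<close> merges them into the strength at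
    \<open>t \<otimes> t\<close>.\<close>
  have "(\<one> (t \<otimes> t) \<boxtimes> \<tau>) \<cdot> (?a \<cdot> ((\<one> t \<boxtimes> mult) \<cdot> mult))
      = (((\<one> t \<boxtimes> \<one> t) \<boxtimes> \<tau>) \<cdot> ?a) \<cdot> ((\<one> t \<boxtimes> mult) \<cdot> mult)"
    by (simp add: tarr_ident cmp_assoc_arr)
  also have "\<dots> = assoc V t t (fobj H t) \<cdot> (((\<one> t \<boxtimes> (\<one> t \<boxtimes> \<tau>)) \<cdot> (\<one> t \<boxtimes> mult)) \<cdot> mult)"
    by (simp add: assoc_naturality[where a = t and b = t and c = "fobj H t"] cmp_assoc_arr)
  also have "\<dots> = assoc V t t (fobj H t)
      \<cdot> ((\<one> t \<boxtimes> \<theta> (t, \<eta>) t) \<cdot> ((\<one> t \<boxtimes> farr H mult) \<cdot> ((\<one> t \<boxtimes> \<tau>) \<cdot> mult)))"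
    by (simp add: interchange[where f' = "\<one> t" and g' = mult] split cmp_assoc_arr)
  also have "\<dots> = assoc V t t (fobj H t)
      \<cdot> ((\<one> t \<boxtimes> \<theta> (t, \<eta>) t) \<cdot> (((\<one> t \<boxtimes> farr H mult) \<cdot> \<theta> (t, \<eta>) t) \<cdot> (farr H mult \<cdot> \<tau>)))"
    by (simp add: mult_action cmp_assoc_arr)
  also have "\<dots> = (assoc V t t (fobj H t) \<cdot> ((\<one> t \<boxtimes> \<theta> (t, \<eta>) t) \<cdot> \<theta> (t, \<eta>) (t \<otimes> t)))
      \<cdot> (farr H (\<one> t \<boxtimes> mult) \<cdot> (farr H mult \<cdot> \<tau>))"
    unfolding nat by (simp add: cmp_assoc_arr)
  also have "\<dots> = \<theta> (t \<otimes> t, e) t \<cdot> farr H (?a \<cdot> ((\<one> t \<boxtimes> mult) \<cdot> mult)) \<cdot> \<tau>"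
    unfolding tensor[symmetric] by (simp add: H.farr_cmp_arr cmp_assoc_arr)
  finally have "mhss_solution V H \<theta> t \<eta> \<tau> (t \<otimes> t) e mult (?a \<cdot> ((\<one> t \<boxtimes> mult) \<cdot> mult))"
    using unit by (simp add: mhss_solution_def hom_iff)
  moreover have "mhss_solution V H \<theta> t \<eta> \<tau> (t \<otimes> t) e mult ((mult \<boxtimes> \<one> t) \<cdot> mult)"
    by (rule pointed_cmp_mult_solution[OF e _ e_mult]) (simp add: hom_iff)
  ultimately have "(mult \<boxtimes> \<one> t) \<cdot> mult = ?a \<cdot> ((\<one> t \<boxtimes> mult) \<cdot> mult)"
    by (intro solution_unique[OF e]) (simp_all add: hom_iff)
  then show ?thesis
    by (simp add: cmp_assoc_arr)
qed

end

theorem theorem3: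
  fixes V :: "('o, 'm, 'x) moncat_scheme"
    and H :: "('o, 'm, 'o, 'm) functor_maps"
    and \<theta> :: "'o \<times> 'm \<Rightarrow> 'o \<Rightarrow> 'm"
    and t :: 'o and \<eta> \<tau> \<mu> :: 'm
  assumes "monoidal_category V"
    and "cat_functor V V H"
    and "pointed_strength V H \<theta>"
    and "mhss V H \<theta> t \<eta> \<tau>"
    and "\<mu> = mhss_morphism V H \<theta> t \<eta> \<tau> t \<eta> (\<one>\<^bsub>V\<^esub> t)"
  shows "H_theta_monoid V H \<theta> t \<eta> \<mu> \<tau>"
proof -
  interpret mhss V H \<theta> t \<eta> \<tau> by fact
  have "\<mu> = mult"
    using assms(5) by (simp add: mult_def)
  then show ?thesis
    by unfold_locales
      (simp_all add: hom_iff mult_left_unit mult_right_unit mult_associative mult_action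
        cmp_assoc_arr unit_hom)
qed

end
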